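(* Let $A$ be a finite set with $k \geq 2$ elements, and let $B$ be a set with at least two elements. Let $f$ be a $B$-valued function of several variables on $A$ with exactly $n$ essential variables, where $n > k$. Then $f$ has a variable identification minor with at least $n - k$ essential variables.
   Context: A $B$-valued function of several variables on $A$ is a mapping $f : A^N \to B$ for some positive integer $N$, called the arity of $f$. The $i$-th variable $x_i$ is essential in $f$ if there are $a_1, \ldots, a_N, b \in A$ such that $f(a_1, \ldots, a_i, \ldots, a_N) \neq f(a_1, \ldots, a_{i-1}, b, a_{i+1}, \ldots, a_N)$. For indices $i \neq j$ in $\{1,\ldots,N\}$ such that both $x_i$ and $x_j$ are essential in $f$, the $N$-ary function $f_{i \gets j}$ defined by $f_{i \gets j}(x_1, \ldots, x_N) = f(x_1, \ldots, x_{i-1}, x_j, x_{i+1}, \ldots, x_N)$ is called a variable identification minor of $f$. *)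

theory Defs
  imports Main "HOL-Library.FuncSet"
begin

text \<open>
  Tuples in \<open>A\<^sup>N\<close> are extensional functions on the index set \<open>{1..N}\<close>, and maps
  \<open>A\<^sup>N \<rightarrow> B\<close> are extensional functions on \<open>tuples A N\<close>, so that distinct HOL functions
  in these sets represent distinct tuples and distinct maps.
\<close>

definition tuples :: "'a set \<Rightarrow> nat \<Rightarrow> (nat \<Rightarrow> 'a) set"
  where "tuples A N = {1..N} \<rightarrow>\<^sub>E A"

definition essential :: "'a set \<Rightarrow> nat \<Rightarrow> ((nat \<Rightarrow> 'a) \<Rightarrow> 'b) \<Rightarrow> nat \<Rightarrow> bool"
  where "essential A N f i \<longleftrightarrow>
    i \<in> {1..N} \<and> (\<exists>a \<in> tuples A N. \<exists>b \<in> A. f a \<noteq> f (a(i := b)))"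

definition essential_vars :: "'a set \<Rightarrow> nat \<Rightarrow> ((nat \<Rightarrow> 'a) \<Rightarrow> 'b) \<Rightarrow> nat set"
  where "essential_vars A N f = {i. essential A N f i}"

definition identify ::
    "'a set \<Rightarrow> nat \<Rightarrow> ((nat \<Rightarrow> 'a) \<Rightarrow> 'b) \<Rightarrow> nat \<Rightarrow> nat \<Rightarrow> ((nat \<Rightarrow> 'a) \<Rightarrow> 'b)"
  where "identify A N f i j = (\<lambda>x \<in> tuples A N. f (x(i := x j)))"

definition variable_identification_minor ::
    "'a set \<Rightarrow> nat \<Rightarrow> ((nat \<Rightarrow> 'a) \<Rightarrow> 'b) \<Rightarrow> ((nat \<Rightarrow> 'a) \<Rightarrow> 'b) \<Rightarrow> bool"
  where "variable_identification_minor A N f g \<longleftrightarrow>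
    (\<exists>i j. i \<noteq> j \<and> essential A N f i \<and> essential A N f j \<and> g = identify A N f i j)"

end

theory Submission
  imports Defs
begin

text \<open>
  Call a variable strongly essential if some constant can be substituted for it so that all other
  essential variables stay essential.  Every function with an essential variable has a strongly
  essential one (\<open>exists_strongly_essential\<close>), so constants \<open>c\<close> can be substituted for a set
  \<open>K\<close> of \<open>k\<close> essential variables while the other \<open>n - k\<close> stay essential
  (\<open>exists_essential_preserving_assignment\<close>).

  If \<open>c\<close> takes the same value at two variables of \<open>K\<close>, then identifying these two already gives a
  minor with \<open>n - k\<close> essential variables, because the substitution takes place on the diagonal where
  they agree (\<open>box_essential_imp_essential_identify\<close>).

  Otherwise \<open>c\<close> is a bijection from \<open>K\<close> onto the \<open>k\<close>-element set \<open>A\<close>.  Substitute a constant \<open>d\<close>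
  for one more strongly essential variable \<open>p\<close>, and let \<open>Y\<close> be the set of the remaining \<open>n - k - 1\<close>
  variables.  Some \<open>i\<close> in \<open>K\<close> has \<open>c i = d\<close>, and all of \<open>Y\<close> is essential in the minor
  identifying \<open>p\<close> with \<open>i\<close>.  Suppose every minor has fewer than \<open>n - k\<close> essential variables.  Then
  exactly \<open>Y\<close> is essential in this minor.  For any other \<open>j\<close> in \<open>K\<close> the diagonals \<open>x\<^sub>p = x\<^sub>i\<close> and
  \<open>x\<^sub>p = x\<^sub>j\<close> meet in \<open>x\<^sub>p = x\<^sub>i = x\<^sub>j\<close>, where the first minor can still be seen in full; so \<open>Y\<close>
  is also essential, and for the same reason of counting exactly essential, in the minor identifying
  \<open>p\<close> with \<open>j\<close>.  Two functions of the variables in \<open>Y\<close> that agree on this intersection agree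
  everywhere.  Hence, once \<open>c\<close> is substituted for \<open>K\<close>, the value of \<open>x\<^sub>p\<close> has no influence: whatever
  it is, it equals some \<open>c j\<close>, and so \<open>f\<close> is computed by the one function of \<open>Y\<close>.  This contradicts
  that \<open>p\<close> stayed essential after the first substitution.
\<close>

section \<open>Essential variables on boxes\<close>

text \<open>
  Substituting constants amounts to shrinking factors of the domain to singletons.  Boxes with
  arbitrary factors therefore allow \<open>f\<close> itself to stay unchanged throughout, and variables with a
  constant substituted are inessential automatically.
\<close>

definition box_essential :: "'i set \<Rightarrow> ('i \<Rightarrow> 'a set) \<Rightarrow> (('i \<Rightarrow> 'a) \<Rightarrow> 'b) \<Rightarrow> 'i set"
  where "box_essential I X f = {q \<in> I. \<exists>x \<in> Pi\<^sub>E I X. \<exists>b \<in> X q. f x \<noteq> f (x(q := b))}"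

lemma box_essentialI:
  "q \<in> I \<Longrightarrow> x \<in> Pi\<^sub>E I X \<Longrightarrow> b \<in> X q \<Longrightarrow> f x \<noteq> f (x(q := b)) \<Longrightarrow> q \<in> box_essential I X f"
  unfolding box_essential_def by blast

lemma box_essentialE:
  assumes "q \<in> box_essential I X f"
  obtains x b where "q \<in> I" "x \<in> Pi\<^sub>E I X" "b \<in> X q" "f x \<noteq> f (x(q := b))"
  using assms unfolding box_essential_def by blast

lemma fun_upd_in_PiE:
  "x \<in> Pi\<^sub>E I X \<Longrightarrow> q \<in> I \<Longrightarrow> b \<in> X q \<Longrightarrow> x(q := b) \<in> Pi\<^sub>E I X"
  by (rule PiE_I) (auto simp: PiE_def extensional_def)

lemma fun_upd_in_PiE_fixed:
  "x \<in> Pi\<^sub>E I X \<Longrightarrow> q \<in> I \<Longrightarrow> x(q := b) \<in> Pi\<^sub>E I (X(q := {b}))"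
  by (rule PiE_I) (auto simp: PiE_def extensional_def)

lemma box_essential_fixed_subset:
  assumes "d \<in> X p"
  shows "box_essential I (X(p := {d})) f \<subseteq> box_essential I X f - {p}"
proof
  fix q assume "q \<in> box_essential I (X(p := {d})) f"
  then obtain x b where q: "q \<in> I" and x: "x \<in> Pi\<^sub>E I (X(p := {d}))"
    and b: "b \<in> (X(p := {d})) q" and ne: "f x \<noteq> f (x(q := b))"
    by (rule box_essentialE)
  have "q \<noteq> p"
  proof
    assume "q = p"
    then have "x q = b" using PiE_mem[OF x q] b by simp
    then show False using ne by (metis fun_upd_triv)
  qed
  moreover have "x \<in> Pi\<^sub>E I X"
    by (rule subsetD[OF PiE_mono x]) (use assms in auto)
  ultimately show "q \<in> box_essential I X f - {p}"
    using q b ne by (auto intro: box_essentialI)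
qed

text \<open>
  Substitute a constant \<open>c\<close> for a variable \<open>i\<close> so that as many variables as possible stay essential.
  If one of them, \<open>j\<close>, is lost, then on \<open>x\<^sub>i = c\<close> the value of \<open>x\<^sub>j\<close> is immaterial, so substituting any
  constant for \<open>j\<close> instead keeps all the survivors; taking that constant from a witness that \<open>i\<close>
  is essential also keeps \<open>i\<close>, one variable more than the maximum.
\<close>

lemma exists_strongly_essential:
  assumes "finite I" and "box_essential I X f \<noteq> {}"
  shows "\<exists>p \<in> box_essential I X f. \<exists>d \<in> X p.
           box_essential I (X(p := {d})) f = box_essential I X f - {p}"
proof -
  let ?E = "box_essential I X f"
  let ?P = "\<lambda>(i, c). i \<in> ?E \<and> c \<in> X i"
  let ?S = "\<lambda>(i, c). box_essential I (X(i := {c})) f"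
  have fin: "finite (box_essential I Z f)" for Z
    using assms(1) by (simp add: box_essential_def)
  obtain i0 where i0: "i0 \<in> ?E" using assms(2) by blast
  then obtain c0 where c0: "c0 \<in> X i0" by (auto elim: box_essentialE)
  have bound: "\<forall>y. ?P y \<longrightarrow> card (?S y) < Suc (card ?E)"
    using box_essential_fixed_subset[of _ X _ I f]
    by (force intro!: le_imp_less_Suc card_mono[OF fin])
  obtain i c where ic: "i \<in> ?E" "c \<in> X i"
    and max: "\<And>j d. j \<in> ?E \<Longrightarrow> d \<in> X j \<Longrightarrow> card (?S (j, d)) \<le> card (?S (i, c))"
    using ex_has_greatest_nat[of ?P "(i0, c0)" "\<lambda>y. card (?S y)", OF _ bound] i0 c0 by auto
  have "?S (i, c) = ?E - {i}"
  proof (rule ccontr)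
    assume "?S (i, c) \<noteq> ?E - {i}"
    then obtain j where j: "j \<in> ?E" "j \<noteq> i" "j \<notin> ?S (i, c)"
      using box_essential_fixed_subset[of c X i I f, OF ic(2)] by auto
    have jI: "j \<in> I" using j(1) by (auto elim: box_essentialE)
    obtain x b where i: "i \<in> I" and x: "x \<in> Pi\<^sub>E I X" "b \<in> X i" "f x \<noteq> f (x(i := b))"
      using ic(1) by (rule box_essentialE)
    define d where "d = x j"
    have d: "d \<in> X j" using x(1) jI by (auto simp: d_def)
    have "x \<in> Pi\<^sub>E I (X(j := {d}))"
      using fun_upd_in_PiE_fixed[OF x(1) jI, of d] by (simp add: d_def)
    then have "i \<in> ?S (j, d)"
      using i x j(2) by (auto intro: box_essentialI)
    moreover have "?S (i, c) \<subseteq> ?S (j, d)"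
    proof
      fix s assume s: "s \<in> ?S (i, c)"
      then obtain y e where y: "s \<in> I" "y \<in> Pi\<^sub>E I (X(i := {c}))" "e \<in> (X(i := {c})) s"
          "f y \<noteq> f (y(s := e))"
        by (auto elim: box_essentialE)
      have "s \<noteq> j" "s \<noteq> i"
        using s j(3) box_essential_fixed_subset[of c X i I f, OF ic(2)] by auto
      have j_irrelevant: "f (z(j := d)) = f z" if "z \<in> Pi\<^sub>E I (X(i := {c}))" for z
        using j(2,3) jI d that by (force intro: box_essentialI)
      have "f (y(j := d)) \<noteq> f ((y(j := d))(s := e))"
        using j_irrelevant[OF y(2)] j_irrelevant[OF fun_upd_in_PiE[OF y(2,1,3)]] y(4) \<open>s \<noteq> j\<close>
        by (simp add: fun_upd_twist)
      moreover have "y \<in> Pi\<^sub>E I X"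
        by (rule subsetD[OF PiE_mono y(2)]) (use ic(2) in auto)
      then have "y(j := d) \<in> Pi\<^sub>E I (X(j := {d}))"
        by (rule fun_upd_in_PiE_fixed[OF _ jI])
      ultimately show "s \<in> ?S (j, d)"
        using y(1,3) \<open>s \<noteq> j\<close> \<open>s \<noteq> i\<close> by (auto intro: box_essentialI)
    qed
    moreover have "i \<notin> ?S (i, c)"
      using box_essential_fixed_subset[of c X i I f, OF ic(2)] by auto
    ultimately have "?S (i, c) \<subset> ?S (j, d)" by blast
    then have "card (?S (i, c)) < card (?S (j, d))"
      using fin by (simp add: psubset_card_mono)
    then show False using max[OF j(1) d] by simp
  qed
  then show ?thesis using ic by auto
qed

lemma exists_essential_preserving_assignment:
  assumes "finite I" and "m \<le> card (box_essential I X f)"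
  shows "\<exists>K c. K \<subseteq> box_essential I X f \<and> card K = m \<and> (\<forall>i \<in> K. c i \<in> X i) \<and>
           box_essential I (\<lambda>i. if i \<in> K then {c i} else X i) f = box_essential I X f - K"
  using assms(2)
proof (induction m)
  case 0
  then show ?case by (auto intro!: exI[of _ "{}"])
next
  case (Suc m)
  let ?E = "box_essential I X f"
  obtain K c where K: "K \<subseteq> ?E" "card K = m" "\<forall>i \<in> K. c i \<in> X i"
    and live: "box_essential I (\<lambda>i. if i \<in> K then {c i} else X i) f = ?E - K"
    using Suc by auto
  have finE: "finite ?E" using assms(1) by (simp add: box_essential_def)
  then have "?E - K \<noteq> {}"
    using K Suc.prems by (metis Diff_eq_empty_iff card_mono finite_subset not_less_eq_eq)
  then obtain p d where p: "p \<in> ?E - K" "d \<in> X p"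
    and step: "box_essential I ((\<lambda>i. if i \<in> K then {c i} else X i)(p := {d})) f = ?E - K - {p}"
    using exists_strongly_essential[OF assms(1), of "\<lambda>i. if i \<in> K then {c i} else X i" f]
    unfolding live by auto
  have "(\<lambda>i. if i \<in> K then {c i} else X i)(p := {d})
      = (\<lambda>i. if i \<in> insert p K then {(c(p := d)) i} else X i)"
    using p(1) by (intro ext) auto
  moreover have "card (insert p K) = Suc m"
    using K p(1) finE by (simp add: finite_subset)
  moreover have "?E - K - {p} = ?E - insert p K" by auto
  ultimately show ?case
    using K p step by (intro exI[of _ "insert p K"] exI[of _ "c(p := d)"]) auto
qed

section \<open>Minors and their diagonals\<close>

lemma essential_vars_eq_box_essential:
  "essential_vars A N f = box_essential {1..N} (\<lambda>_. A) f"
  by (auto simp: essential_vars_def essential_def box_essential_def tuples_def)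

lemma tuples_upd: "x \<in> tuples A N \<Longrightarrow> q \<in> {1..N} \<Longrightarrow> b \<in> A \<Longrightarrow> x(q := b) \<in> tuples A N"
  unfolding tuples_def by (rule fun_upd_in_PiE)

lemma tuples_mem: "x \<in> tuples A N \<Longrightarrow> q \<in> {1..N} \<Longrightarrow> x q \<in> A"
  unfolding tuples_def by auto

lemma inessential_upd:
  assumes "q \<notin> essential_vars A N g" "x \<in> tuples A N" "q \<in> {1..N}" "b \<in> A"
  shows "g (x(q := b)) = g x"
proof (rule ccontr)
  assume "g (x(q := b)) \<noteq> g x"
  then have "essential A N g q"
    using assms unfolding essential_def by metis
  then show False using assms(1) by (simp add: essential_vars_def)
qed

lemma identify_on_diagonal:
  "x \<in> tuples A N \<Longrightarrow> x i = x j \<Longrightarrow> identify A N f i j x = f x"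
  by (simp add: identify_def fun_upd_idem)

lemma box_essential_imp_essential_identify:
  assumes "q \<in> box_essential {1..N} X f" and "\<And>l. X l \<subseteq> A"
    and "i \<in> {1..N}" "j \<in> {1..N}" "X i = {a}" "X j = {a}"
  shows "q \<in> essential_vars A N (identify A N f i j)"
proof -
  obtain x b where q: "q \<in> {1..N}" and x: "x \<in> Pi\<^sub>E {1..N} X" and b: "b \<in> X q"
    and ne: "f x \<noteq> f (x(q := b))"
    using assms(1) by (rule box_essentialE)
  \<comment> \<open>Both ends of the witness lie in the box, and the box lies in the diagonal.\<close>
  have diag: "identify A N f i j y = f y \<and> y \<in> tuples A N" if y: "y \<in> Pi\<^sub>E {1..N} X" for y
  proof -
    have "y \<in> tuples A N"
      using y PiE_mono[of "{1..N}" X "\<lambda>_. A"] assms(2) by (auto simp: tuples_def)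
    moreover have "y i = y j" using PiE_mem[OF y] assms(3-6) by (metis singletonD)
    ultimately show ?thesis by (simp add: identify_on_diagonal)
  qed
  have "identify A N f i j x \<noteq> identify A N f i j (x(q := b))"
    using diag[OF x] diag[OF fun_upd_in_PiE[OF x q b]] ne by simp
  moreover have "x \<in> tuples A N" "b \<in> A" using diag[OF x] b assms(2) by auto
  ultimately show ?thesis using q by (auto simp: essential_vars_def essential_def)
qed

text \<open>
  If \<open>x\<^sub>j\<close> does not matter on the diagonal \<open>x\<^sub>p = x\<^sub>i\<close>, then a witness there can be moved to
  \<open>x\<^sub>p = x\<^sub>i = x\<^sub>j\<close>, which is also part of the diagonal \<open>x\<^sub>p = x\<^sub>j\<close>.
\<close>

lemma essential_identify_transfer:
  assumes "p \<in> {1..N}" "i \<in> {1..N}" "j \<in> {1..N}"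
    and j: "j \<notin> essential_vars A N (identify A N f p i)"
    and p: "p \<notin> essential_vars A N (identify A N f p i)"
    and q: "q \<in> essential_vars A N (identify A N f p i)" "q \<noteq> i"
  shows "q \<in> essential_vars A N (identify A N f p j)"
proof -
  let ?g = "identify A N f p i" and ?h = "identify A N f p j"
  obtain z b where z: "z \<in> tuples A N" and b: "b \<in> A" and qN: "q \<in> {1..N}"
    and ne: "?g z \<noteq> ?g (z(q := b))"
    using q(1) by (auto simp: essential_vars_def essential_def)
  define M where "M = (\<lambda>y :: nat \<Rightarrow> 'a. y(p := y i, j := y i))"
  have M: "M y \<in> tuples A N \<and> ?h (M y) = ?g y" if y: "y \<in> tuples A N" for y
  proof -
    have yi: "y i \<in> A" using tuples_mem[OF y assms(2)] .
    have y1: "y(p := y i) \<in> tuples A N" using tuples_upd[OF y assms(1) yi] .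
    have My: "M y \<in> tuples A N" using tuples_upd[OF y1 assms(3) yi] by (simp add: M_def)
    have "?h (M y) = f (M y)" "?g (M y) = f (M y)"
      by (intro identify_on_diagonal[OF My]; simp add: M_def)+
    moreover have "?g (M y) = ?g y"
      unfolding M_def
      using inessential_upd[OF j y1 assms(3) yi] inessential_upd[OF p y assms(1) yi] by simp
    ultimately show ?thesis using My by simp
  qed
  have "q \<noteq> p" "q \<noteq> j" using q j p by auto
  then have "M (z(q := b)) = (M z)(q := b)"
    using q(2) by (auto simp: M_def)
  then have "?h (M z) \<noteq> ?h ((M z)(q := b))"
    using M[OF z] M[OF tuples_upd[OF z qN b]] ne by simp
  then show ?thesis
    using M[OF z] b qN unfolding essential_vars_def essential_def by blast
qed

text \<open>
  The path from \<open>x\<close> to \<open>x(p := x i)\<close> first moves \<open>x\<^sub>p\<close> and \<open>x\<^sub>j\<close> to the value \<open>x i\<close> together, inside one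
  diagonal, and then restores \<open>x\<^sub>j\<close> inside the other.
\<close>

lemma eq_across_diagonals:
  assumes "p \<in> {1..N}" "i \<in> {1..N}" "j \<in> {1..N}" "i \<noteq> j" "p \<noteq> i" "p \<noteq> j"
    and gj: "j \<notin> essential_vars A N (identify A N f p i)"
    and hj: "j \<notin> essential_vars A N (identify A N f p j)"
    and hp: "p \<notin> essential_vars A N (identify A N f p j)"
    and x: "x \<in> tuples A N" "x p = x j"
  shows "f x = f (x(p := x i))"
proof -
  let ?g = "identify A N f p i" and ?h = "identify A N f p j"
  have xi: "x i \<in> A" using tuples_mem[OF x(1) assms(2)] .
  have x1: "x(p := x i) \<in> tuples A N" using tuples_upd[OF x(1) assms(1) xi] .
  have x2: "x(p := x i, j := x i) \<in> tuples A N" using tuples_upd[OF x1 assms(3) xi] .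
  have "f x = ?h x" by (rule identify_on_diagonal[OF x, symmetric])
  also have "\<dots> = ?h (x(p := x i, j := x i))"
    using inessential_upd[OF hj x1 assms(3) xi] inessential_upd[OF hp x(1) assms(1) xi] by simp
  also have "\<dots> = f (x(p := x i, j := x i))" by (rule identify_on_diagonal[OF x2]) simp
  also have "\<dots> = ?g (x(p := x i, j := x i))"
    by (rule identify_on_diagonal[OF x2, symmetric]) (use assms in simp)
  also have "\<dots> = ?g (x(p := x i))" using inessential_upd[OF gj x1 assms(3) xi] .
  also have "\<dots> = f (x(p := x i))"
    by (rule identify_on_diagonal[OF x1]) (use assms in simp)
  finally show ?thesis .
qed

section \<open>The bound on the number of lost variables\<close>

theorem theorem3:
  fixes A :: "'a set" and B :: "'b set" and k n N :: nat
    and f :: "(nat \<Rightarrow> 'a) \<Rightarrow> 'b"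
  assumes "finite A" and "card A = k" and "k \<ge> 2"
    and "\<exists>b \<in> B. \<exists>b' \<in> B. b \<noteq> b'"
    and "N \<ge> 1"
    and "f \<in> tuples A N \<rightarrow>\<^sub>E B"
    and "card (essential_vars A N f) = n"
    and "n > k"
  shows "\<exists>g. variable_identification_minor A N f g \<and>
             card (essential_vars A N g) \<ge> n - k"
proof (rule ccontr)
  assume no_minor: "\<not> ?thesis"
  let ?E = "essential_vars A N f"
  let ?V = "\<lambda>i j. essential_vars A N (identify A N f i j)"
  have EN: "?E \<subseteq> {1..N}" by (auto simp: essential_vars_def essential_def)
  have finV: "finite (essential_vars A N g)" for g :: "(nat \<Rightarrow> 'a) \<Rightarrow> 'b"
    by (rule finite_subset[of _ "{1..N}"]) (auto simp: essential_vars_def essential_def)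
  have small: "card (?V i j) < n - k" if "i \<in> ?E" "j \<in> ?E" "i \<noteq> j" for i j
    using no_minor that unfolding variable_identification_minor_def essential_vars_def
    by (metis mem_Collect_eq not_le)
  obtain K c where K: "K \<subseteq> ?E" "card K = k" "\<forall>i \<in> K. c i \<in> A"
    and live: "box_essential {1..N} (\<lambda>i. if i \<in> K then {c i} else A) f = ?E - K"
    using exists_essential_preserving_assignment[of "{1..N}" k "\<lambda>_. A" f] assms(7,8)
    by (auto simp: essential_vars_eq_box_essential)
  define X where "X = (\<lambda>i. if i \<in> K then {c i} else A)"
  have XA: "X l \<subseteq> A" for l using K(3) by (auto simp: X_def)
  have finK: "finite K" using finite_subset[OF K(1) finV] .
  have card_rest: "card (?E - K) = n - k"
    using K(1,2) assms(7) finK by (simp add: card_Diff_subset)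
  have "inj_on c K"
  proof (rule inj_onI, rule ccontr)
    fix i j assume ij: "i \<in> K" "j \<in> K" "c i = c j" "i \<noteq> j"
    have "?E - K \<subseteq> ?V i j"
    proof
      fix q assume "q \<in> ?E - K"
      then have "q \<in> box_essential {1..N} X f" unfolding X_def live .
      then show "q \<in> ?V i j"
        by (rule box_essential_imp_essential_identify[where a = "c i"])
          (use XA ij K(1) EN in \<open>auto simp: X_def\<close>)
    qed
    then have "n - k \<le> card (?V i j)" using card_mono[OF finV] card_rest by metis
    then show False using small[of i j] ij K(1) by auto
  qed
  then have cK: "c ` K = A"
    using K assms(1,2) by (intro card_subset_eq) (auto simp: card_image)
  have "?E - K \<noteq> {}" using card_rest assms(8) by (metis card.empty zero_less_diff less_irrefl)
  then obtain p d where p: "p \<in> ?E - K" and d: "d \<in> X p"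
    and live_p: "box_essential {1..N} (X(p := {d})) f = ?E - K - {p}"
    using exists_strongly_essential[of "{1..N}" X f] live by (auto simp: X_def)
  define Y where "Y = ?E - K - {p}"
  have card_Y: "Suc (card Y) = n - k"
    using p card_rest finV assms(8) by (simp add: Y_def)
  obtain i where i: "i \<in> K" "c i = d" using cK d XA by blast
  have only_Y: "?V p j = Y" if "j \<in> K" "Y \<subseteq> ?V p j" for j
  proof -
    have "p \<noteq> j" using p that(1) by blast
    then have "card (?V p j) \<le> card Y"
      using small[of p j] that(1) p K(1) card_Y by (metis DiffD1 less_Suc_eq_le subsetD)
    then show ?thesis using card_seteq[OF finV that(2)] by simp
  qed
  have V_i: "?V p i = Y"
  proof (rule only_Y[OF i(1)], rule subsetI)
    fix q assume "q \<in> Y"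
    then have "q \<in> box_essential {1..N} (X(p := {d})) f" unfolding live_p Y_def .
    then show "q \<in> ?V p i"
    proof (rule box_essential_imp_essential_identify[where a = d])
      show "(X(p := {d})) l \<subseteq> A" for l using XA d by auto
      show "p \<in> {1..N}" "i \<in> {1..N}" using i(1) p K(1) EN by blast+
      show "(X(p := {d})) p = {d}" by simp
      have "p \<noteq> i" using i(1) p by blast
      then show "(X(p := {d})) i = {d}" using i by (simp add: X_def)
    qed
  qed
  have pN: "p \<in> {1..N}" and KN: "K \<subseteq> {1..N}" using p K(1) EN by auto
  have V_j: "?V p j = Y" if "j \<in> K" for j
  proof (rule only_Y[OF that], rule subsetI)
    fix q assume q: "q \<in> Y"
    show "q \<in> ?V p j"
    proof (rule essential_identify_transfer[OF pN, of i j])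
      show "i \<in> {1..N}" "j \<in> {1..N}" using i(1) that KN by blast+
      show "j \<notin> ?V p i" "p \<notin> ?V p i" "q \<in> ?V p i" "q \<noteq> i"
        unfolding V_i using q that i(1) by (auto simp: Y_def)
    qed
  qed
  have p_irrelevant: "f x = f (x(p := d))" if x: "x \<in> Pi\<^sub>E {1..N} X" for x
  proof -
    have xt: "x \<in> tuples A N"
      using x PiE_mono[of "{1..N}" X "\<lambda>_. A"] XA by (auto simp: tuples_def)
    have xK: "x l = c l" if "l \<in> K" for l
      using PiE_mem[OF x, of l] that KN by (auto simp: X_def)
    \<comment> \<open>Since \<open>c\<close> maps onto \<open>A\<close>, every point of the box lies on a diagonal through \<open>p\<close> and \<open>K\<close>.\<close>
    obtain j where j: "j \<in> K" "x p = c j" using cK tuples_mem[OF xt pN] by blast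
    show ?thesis
    proof (cases "j = i")
      case True
      then have "x p = d" using i(2) j(2) by simp
      then have "x(p := d) = x" by (rule fun_upd_idem)
      then show ?thesis by simp
    next
      case False
      have "f x = f (x(p := x i))"
      proof (rule eq_across_diagonals[OF pN, of i j])
        show "i \<in> {1..N}" "j \<in> {1..N}" using i(1) j(1) KN by blast+
        show "i \<noteq> j" "p \<noteq> i" "p \<noteq> j" using False i(1) j(1) p by blast+
        show "j \<notin> ?V p i" "j \<notin> ?V p j" "p \<notin> ?V p j"
          unfolding V_i V_j[OF j(1)] using j(1) by (auto simp: Y_def)
        show "x p = x j" using xK[OF j(1)] j(2) by simp
      qed (rule xt)
      then show ?thesis using xK[OF i(1)] i(2) by simp
    qed
  qed
  have "p \<in> box_essential {1..N} X f" using p unfolding X_def live by blast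
  then obtain x b where x: "x \<in> Pi\<^sub>E {1..N} X" "b \<in> X p" "f x \<noteq> f (x(p := b))"
    by (rule box_essentialE)
  then show False
    using p_irrelevant[OF x(1)] p_irrelevant[OF fun_upd_in_PiE[OF x(1) pN x(2)]] by simp
qed

end
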